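(* Let $X$ be a nonempty finite set, $\Theta$ a nonempty set, and $(\mathsf P_\theta)_{\theta\in\Theta}$ a family of probability measures on the sigma-algebra of all subsets of $X$. For $x\in X$ let $\ell_x\colon\Theta\to\mathbb R$, $\ell_x(\theta):=\mathsf P_\theta(\{x\})$. Let $T\colon X\to\mathbb R$ be a statistic, and for each $t\in T(X):=\{T(x)\colon x\in X\}$ let $B_t$ be any linear basis of the set $\{\ell_x\colon x\in X,\ T(x)=t\}$ of likelihood functions. Let "best" stand either for "UUBUE" or for "$\mathfrak L$-UBUE", where $\mathfrak L\in\mathcal C$ is any given loss function. Then, for each of these meanings of "best": (1) $T$ is best if and only if the union $\bigcup_{t\in T(X)}B_t$ of the bases is linearly independent. (2) If $T$ is best, then $u\circ T$ is best for every function $u\colon\mathbb R\to\mathbb R$. (3) If $T$ is best, then $T$ is complete.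
   Context: The set $X$ of samples is nonempty and finite, equipped with the sigma-algebra of all its subsets; the parameter space $\Theta$ is an arbitrary nonempty set. A statistic is any function $T\colon X\to\mathbb R$. $\mathsf E_\theta$ denotes expectation with respect to $\mathsf P_\theta$. $\mathcal E_0$ is the set of all statistics $H$ with $\mathsf E_\theta H=0$ for all $\theta\in\Theta$. The function $\ell_x$ is called the likelihood function corresponding to the sample $x$. A loss function is a function $\mathfrak L\colon\Theta\times\mathbb R\to\mathbb R$; it is convex if $t\mapsto\mathfrak L(\theta,t)$ is convex on $\mathbb R$ for each $\theta\in\Theta$. A statistic $T$ is a uniformly best unbiased estimator with respect to $\mathfrak L$ ($\mathfrak L$-UBUE) if, for every statistic $S$ such that $S-T\in\mathcal E_0$, one has $\mathsf E_\theta\mathfrak L(\theta,T)\le\mathsf E_\theta\mathfrak L(\theta,S)$ for all $\theta\in\Theta$. Here $\mathfrak L(\theta,T)$ denotes the statistic $x\mapsto\mathfrak L(\theta,T(x))$. A statistic $T$ is a universally uniformly best unbiased estimator (UUBUE) if it is an $\mathfrak L$-UBUE for all convex loss functions $\mathfrak L$. $\mathcal C$ is the set of all loss functions of the form $\mathfrak L(\theta,t)=\mathfrak c(t)$ for all $(\theta,t)\in\Theta\times\mathbb R$, where $\mathfrak c\colon\mathbb R\to\mathbb R$ is any differentiable strictly convex function. A set $N\subseteq X$ is a null set if $\mathsf P_\theta(N)=0$ for all $\theta\in\Theta$. A statistic $T$ is complete if, for every Borel-measurable $u\colon\mathbb R\to\mathbb R$ such that $u\circ T\in\mathcal E_0$,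 one has $u\circ T=0$ except on a null set. A linear basis of a set $A$ of functions from $\Theta$ to $\mathbb R$ is a linearly independent subset of $A$ having the same linear span as $A$; in particular, $B_t$ is empty if $\ell_x=0$ for all $x\in X$ with $T(x)=t$. The sum of an empty family is taken to be zero. Linear independence is in the real vector space $\mathbb R^\Theta$ of all functions from $\Theta$ to $\mathbb R$.
   Formalization: In (1) the union of the bases is taken as a disjoint union: the family of all b in B_t, indexed by pairs (t,b), must be linearly independent, so a function lying in two different B_t makes it dependent; with the plain set union the claim is false. *)

theory Defs
  imports "HOL-Probability.Probability" "HOL-Library.Function_Algebras"
begin

text \<open>
  The sample space is a type of class finite and the parameter set is an arbitrary type;
  statistics are functions from samples to reals.
\<close>

subsection \<open>The real vector space of functions\<close>

instantiation "fun" :: (type, real_vector) real_vector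
begin

definition "c *\<^sub>R f = (\<lambda>x. c *\<^sub>R f x)"

instance
  by standard (simp_all add: scaleR_fun_def fun_eq_iff scaleR_add_right scaleR_add_left)

end

lemma scaleR_fun_apply [simp]: "(c *\<^sub>R f) x = c *\<^sub>R f x"
  by (simp add: scaleR_fun_def)

definition linear_basis :: "'v::real_vector set \<Rightarrow> 'v set \<Rightarrow> bool" where
  "linear_basis B A \<longleftrightarrow> B \<subseteq> A \<and> independent B \<and> span B = span A"

text \<open>
  Linear independence of an indexed family, so that a vector occurring at two indices
  makes the family dependent. The union of the bases over the levels of a statistic has to be
  understood as such a family, indexed by the pairs of a level and a basis element. As a plain
  set union it would lose information: for two samples with the same nonzero likelihood
  function but different values of the statistic, the union is a single nonzero function.
\<close>

definition independent_family :: "'i set \<Rightarrow> ('i \<Rightarrow> 'v::real_vector) \<Rightarrow> bool" where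
  "independent_family I v \<longleftrightarrow>
     (\<forall>J c. finite J \<and> J \<subseteq> I \<and> (\<Sum>i\<in>J. c i *\<^sub>R v i) = 0 \<longrightarrow> (\<forall>i\<in>J. c i = 0))"

lemma independent_family_iff:
  "independent_family I v \<longleftrightarrow> inj_on v I \<and> independent (v ` I)"
proof (intro iffI conjI)
  assume fam: "independent_family I v"
  show inj: "inj_on v I"
  proof (rule inj_onI, rule ccontr)
    fix i j assume ij: "i \<in> I" "j \<in> I" "v i = v j" "i \<noteq> j"
    define c :: "'a \<Rightarrow> real" where "c = (\<lambda>k. if k = i then 1 else -1)"
    have "(\<Sum>k\<in>{i,j}. c k *\<^sub>R v k) = 0" using ij by (simp add: c_def)
    then have "c i = 0" using fam ij unfolding independent_family_def
      by (metis bot_least finite.emptyI finite.insertI insert_iff insert_subset)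
    then show False by (simp add: c_def)
  qed
  show "independent (v ` I)"
    unfolding independent_explicit_module
  proof (intro allI impI)
    fix S u w assume S: "finite S" "S \<subseteq> v ` I" "(\<Sum>w\<in>S. u w *\<^sub>R w) = 0" "w \<in> S"
    obtain J where J: "J \<subseteq> I" "finite J" "S = v ` J"
      using S(1,2) finite_subset_image by metis
    have "(\<Sum>i\<in>J. u (v i) *\<^sub>R v i) = 0"
      using S(3) inj_on_subset[OF inj J(1)] unfolding J(3) by (simp add: sum.reindex)
    then have "\<forall>i\<in>J. u (v i) = 0"
      using fam J unfolding independent_family_def by (elim allE[of _ J] allE[of _ "u \<circ> v"]) auto
    then show "u w = 0" using S(4) J(3) by auto
  qed
next
  assume *: "inj_on v I \<and> independent (v ` I)"
  show "independent_family I v"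
    unfolding independent_family_def
  proof (intro allI impI ballI)
    fix J c i assume J: "finite J \<and> J \<subseteq> I \<and> (\<Sum>i\<in>J. c i *\<^sub>R v i) = 0" and i: "i \<in> J"
    have inj: "inj_on v J" using * J inj_on_subset by blast
    let ?u = "\<lambda>w. c (the_inv_into J v w)"
    have "(\<Sum>w\<in>v ` J. ?u w *\<^sub>R w) = (\<Sum>i\<in>J. c i *\<^sub>R v i)"
      using inj by (simp add: sum.reindex the_inv_into_f_f)
    moreover have "independent (v ` J)"
      using * J independent_mono image_mono by metis
    ultimately have "?u (v i) = 0"
      using J i independentD[of "v ` J" "v ` J" ?u "v i"] by auto
    then show "c i = 0" using inj i by (simp add: the_inv_into_f_f)
  qed
qed

subsection \<open>Unbiased estimation\<close>

definition likelihood :: "('p \<Rightarrow> 'x measure) \<Rightarrow> 'x \<Rightarrow> 'p \<Rightarrow> real" where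
  "likelihood P x \<theta> = measure (P \<theta>) {x}"

definition zero_mean :: "('p \<Rightarrow> 'x measure) \<Rightarrow> ('x \<Rightarrow> real) set" where
  "zero_mean P = {H. \<forall>\<theta>. (\<integral>x. H x \<partial>P \<theta>) = 0}"

definition convex_loss :: "('p \<Rightarrow> real \<Rightarrow> real) \<Rightarrow> bool" where
  "convex_loss L \<longleftrightarrow> (\<forall>\<theta>. convex_on UNIV (L \<theta>))"

definition UBUE :: "('p \<Rightarrow> 'x measure) \<Rightarrow> ('p \<Rightarrow> real \<Rightarrow> real) \<Rightarrow> ('x \<Rightarrow> real) \<Rightarrow> bool" where
  "UBUE P L T \<longleftrightarrow>
     (\<forall>S. (\<lambda>x. S x - T x) \<in> zero_mean P \<longrightarrow>
        (\<forall>\<theta>. (\<integral>x. L \<theta> (T x) \<partial>P \<theta>) \<le> (\<integral>x. L \<theta> (S x) \<partial>P \<theta>)))"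

definition UUBUE :: "('p \<Rightarrow> 'x measure) \<Rightarrow> ('x \<Rightarrow> real) \<Rightarrow> bool" where
  "UUBUE P T \<longleftrightarrow> (\<forall>L. convex_loss L \<longrightarrow> UBUE P L T)"

definition strictly_convex :: "(real \<Rightarrow> real) \<Rightarrow> bool" where
  "strictly_convex c \<longleftrightarrow>
     (\<forall>s t \<alpha>. s \<noteq> t \<and> 0 < \<alpha> \<and> \<alpha> < 1 \<longrightarrow>
        c ((1 - \<alpha>) * s + \<alpha> * t) < (1 - \<alpha>) * c s + \<alpha> * c t)"

definition simple_losses :: "('p \<Rightarrow> real \<Rightarrow> real) set" where
  "simple_losses = {(\<lambda>\<theta>. c) | c. c differentiable_on UNIV \<and> strictly_convex c}"

definition null_set :: "('p \<Rightarrow> 'x measure) \<Rightarrow> 'x set \<Rightarrow> bool" where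
  "null_set P N \<longleftrightarrow> (\<forall>\<theta>. measure (P \<theta>) N = 0)"

definition complete_statistic :: "('p \<Rightarrow> 'x measure) \<Rightarrow> ('x \<Rightarrow> real) \<Rightarrow> bool" where
  "complete_statistic P T \<longleftrightarrow>
     (\<forall>u \<in> borel_measurable borel. u \<circ> T \<in> zero_mean P \<longrightarrow>
        (\<exists>N. null_set P N \<and> (\<forall>x. x \<notin> N \<longrightarrow> (u \<circ> T) x = 0)))"

end

theory Submission
  imports Defs
begin

text \<open>
  Every meaning of ``best'' is equivalent to the same algebraic condition on \<open>T\<close>: the space of
  zero-mean statistics is closed under multiplication by all functions of \<open>T\<close>.
  If it holds, applying it to a subgradient of the loss at \<open>T\<close> shows that a zero-mean perturbation
  cannot decrease the risk. Conversely, if \<open>T\<close> minimises the risk for a differentiable strictly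
  convex \<open>c\<close>, the first-order condition says that multiplication by \<open>c' \<circ> T\<close> preserves zero mean;
  since \<open>c'\<close> is injective, every function of \<open>T\<close> is a polynomial in \<open>c' \<circ> T\<close>.
  Zero-mean statistics are the linear relations between the likelihood functions, so the condition
  says that every relation splits into relations within the levels of \<open>T\<close>.
\<close>

section \<open>Sums of functions and strictly convex functions\<close>

lemma sum_scaleR_fun_apply:
  fixes v :: "'i \<Rightarrow> 'a \<Rightarrow> 'b::real_vector"
  shows "(\<Sum>i\<in>I. c i *\<^sub>R v i) a = (\<Sum>i\<in>I. c i *\<^sub>R v i a)"
  by (induction I rule: infinite_finite_induct) auto

lemma strictly_convex_imp_convex:
  assumes "strictly_convex c"
  shows "convex_on UNIV c"
proof (rule convex_onI)
  fix t x y :: real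
  assume "0 < t" "t < 1"
  then show "c ((1 - t) *\<^sub>R x + t *\<^sub>R y) \<le> (1 - t) * c x + t * c y"
    using assms[unfolded strictly_convex_def, rule_format, of x y t]
    by (cases "x = y") (auto simp: algebra_simps)
qed simp

text \<open>With equal slopes at \<open>x\<close> and \<open>y\<close>, the two tangent inequalities
  together put the value at the midpoint at or above the mean of the end values, which strict
  convexity forbids.\<close>

lemma strictly_convex_deriv_inj:
  assumes c: "strictly_convex c"
    and deriv: "\<And>t. (c has_real_derivative c' t) (at t)"
  shows "inj c'"
proof (rule injI, rule ccontr)
  fix x y
  assume eq: "c' x = c' y" and "x \<noteq> y"
  have tangent: "c s \<ge> c t + c' t * (s - t)" for s t
    using convex_on_imp_above_tangent[OF strictly_convex_imp_convex[OF c], of t s "c' t"] deriv[of t]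
    by simp
  have "c ((1 - 1/2) * x + 1/2 * y) < (1 - 1/2) * c x + 1/2 * c y"
    using c[unfolded strictly_convex_def, rule_format, of x y "1/2"] \<open>x \<noteq> y\<close> by simp
  moreover have "c ((x + y) / 2) \<ge> c x + c' x * ((y - x) / 2)"
    using tangent[of x "(x + y) / 2"] by (simp add: field_simps)
  moreover have "c x \<ge> c y - c' x * (y - x)"
    using tangent[of y x] eq by (simp add: algebra_simps)
  ultimately show False
    by (simp add: field_simps)
qed

text \<open>A concrete simple loss, through which the UUBUE case reduces to that of a single
  loss.\<close>

lemma square_simple_loss: "(\<lambda>\<theta> t. t\<^sup>2) \<in> simple_losses"
proof -
  have "(\<lambda>t::real. t\<^sup>2) differentiable_on UNIV"
    by (simp add: differentiable_on_def)
  moreover have "strictly_convex (\<lambda>t. t\<^sup>2)"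
    unfolding strictly_convex_def
  proof (intro allI impI)
    fix s t \<alpha> :: real
    assume "s \<noteq> t \<and> 0 < \<alpha> \<and> \<alpha> < 1"
    \<comment> \<open>This product is exactly the gap between the two sides of the strict convexity
      inequality.\<close>
    then have "0 < \<alpha> * (1 - \<alpha>) * (s - t)\<^sup>2"
      by simp
    then show "((1 - \<alpha>) * s + \<alpha> * t)\<^sup>2 < (1 - \<alpha>) * s\<^sup>2 + \<alpha> * t\<^sup>2"
      by (simp add: power2_eq_square algebra_simps)
  qed
  ultimately show ?thesis
    unfolding simple_losses_def by blast
qed

section \<open>Zero-mean statistics as linear relations between likelihood functions\<close>

locale finite_model =
  fixes P :: "'p \<Rightarrow> 'x::finite measure"
  assumes prob: "\<And>\<theta>. prob_space (P \<theta>)"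
    and sets: "\<And>\<theta>. sets (P \<theta>) = UNIV"
begin

lemma integral_eq_sum_likelihood:
  "(\<integral>x. f x \<partial>P \<theta>) = (\<Sum>x\<in>UNIV. f x * likelihood P x \<theta>)" for f :: "'x \<Rightarrow> real"
proof -
  interpret prob_space "P \<theta>" by (rule prob)
  have "(\<integral>x. f x \<partial>P \<theta>) = (\<integral>x. (\<Sum>y\<in>UNIV. f y * indicator {y} x) \<partial>P \<theta>)"
    by (intro Bochner_Integration.integral_cong)
      (auto simp: indicator_def if_distrib sum.delta cong: if_cong)
  also have "\<dots> = (\<Sum>y\<in>UNIV. \<integral>x. f y * indicator {y} x \<partial>P \<theta>)"
    by (intro Bochner_Integration.integral_sum integrable_mult_right integrable_real_indicator)
      (auto simp: sets emeasure_eq_measure)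
  also have "\<dots> = (\<Sum>x\<in>UNIV. f x * likelihood P x \<theta>)"
    using sets_eq_imp_space_eq[of "P \<theta>" "count_space UNIV"] sets[of \<theta>]
    by (simp add: likelihood_def)
  finally show ?thesis .
qed

lemma zero_mean_iff: "H \<in> zero_mean P \<longleftrightarrow> (\<Sum>x\<in>UNIV. H x *\<^sub>R likelihood P x) = 0"
  by (simp add: zero_mean_def integral_eq_sum_likelihood fun_eq_iff sum_scaleR_fun_apply)

lemma zero_mean_add: "G \<in> zero_mean P \<Longrightarrow> H \<in> zero_mean P \<Longrightarrow> (\<lambda>x. G x + H x) \<in> zero_mean P"
  by (simp add: zero_mean_iff scaleR_left_distrib sum.distrib)

lemma zero_mean_mult: "H \<in> zero_mean P \<Longrightarrow> (\<lambda>x. a * H x) \<in> zero_mean P"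
  by (simp add: zero_mean_iff scaleR_scaleR[symmetric] scaleR_sum_right[symmetric] del: scaleR_scaleR)

lemma zero_mean_sum: "(\<And>i. i \<in> I \<Longrightarrow> H i \<in> zero_mean P) \<Longrightarrow> (\<lambda>x. \<Sum>i\<in>I. H i x) \<in> zero_mean P"
proof (induction I rule: infinite_finite_induct)
  case (insert i I)
  then show ?case by (simp add: zero_mean_add)
qed (simp_all add: zero_mean_iff)

section \<open>Multipliers of the zero-mean statistics\<close>

text \<open>These statistics form an algebra containing the constants, so polynomials in a
  multiplier are again multipliers.\<close>

definition zero_mean_multiplier :: "('x \<Rightarrow> real) \<Rightarrow> bool" where
  "zero_mean_multiplier G \<longleftrightarrow> (\<forall>H\<in>zero_mean P. (\<lambda>x. G x * H x) \<in> zero_mean P)"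

lemma zero_mean_multiplier_mult:
  "zero_mean_multiplier F \<Longrightarrow> zero_mean_multiplier G \<Longrightarrow> zero_mean_multiplier (\<lambda>x. F x * G x)"
  by (simp add: zero_mean_multiplier_def mult.assoc)

text \<open>The shape is that of one factor of a Lagrange polynomial. For \<open>b = 0\<close> the
  quotient is 0 by convention, again a multiplier.\<close>

lemma zero_mean_multiplier_affine:
  assumes "zero_mean_multiplier G"
  shows "zero_mean_multiplier (\<lambda>x. (G x - a) / b)"
  unfolding zero_mean_multiplier_def
proof
  fix H assume H: "H \<in> zero_mean P"
  have "(\<lambda>x. (1 / b) * (G x * H x) + (- a / b) * H x) \<in> zero_mean P"
    using assms H by (intro zero_mean_add zero_mean_mult) (auto simp: zero_mean_multiplier_def)
  moreover have "(1 / b) * (G x * H x) + (- a / b) * H x = (G x - a) / b * H x" for x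
    by (simp add: diff_divide_distrib algebra_simps)
  ultimately show "(\<lambda>x. (G x - a) / b * H x) \<in> zero_mean P"
    by simp
qed

lemma zero_mean_multiplier_prod:
  "(\<And>i. i \<in> I \<Longrightarrow> zero_mean_multiplier (G i)) \<Longrightarrow> zero_mean_multiplier (\<lambda>x. \<Prod>i\<in>I. G i x)"
proof (induction I rule: infinite_finite_induct)
  case (insert i I)
  then show ?case by (simp add: zero_mean_multiplier_mult)
qed (simp_all add: zero_mean_multiplier_def)

lemma zero_mean_multiplier_sum:
  assumes "\<And>i. i \<in> I \<Longrightarrow> zero_mean_multiplier (G i)"
  shows "zero_mean_multiplier (\<lambda>x. \<Sum>i\<in>I. a i * G i x)"
  using assms unfolding zero_mean_multiplier_def
  by (auto simp: sum_distrib_right mult.assoc intro!: zero_mean_sum zero_mean_mult)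

lemma multiplier_fun_of_injective:
  assumes G: "zero_mean_multiplier (\<lambda>x. g (T x))" and g: "inj g"
  shows "zero_mean_multiplier (\<lambda>x. w (T x))"
proof -
  txt \<open>Lagrange interpolation at the nodes \<open>g t\<close>, with \<open>t\<close> ranging over the values of \<open>T\<close>.\<close>
  define lagrange where
    "lagrange t x = (\<Prod>s\<in>range T - {t}. (g (T x) - g s) / (g t - g s))" for t x
  have "zero_mean_multiplier (lagrange t)" for t
    unfolding lagrange_def
    by (intro zero_mean_multiplier_prod zero_mean_multiplier_affine G)
  then have "zero_mean_multiplier (\<lambda>x. \<Sum>t\<in>range T. w t * lagrange t x)"
    by (intro zero_mean_multiplier_sum)
  \<comment> \<open>For \<open>t = T x\<close> every factor is 1, its denominator being nonzero by
    injectivity of \<open>g\<close>; otherwise the factor at \<open>s = T x\<close>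
    vanishes.\<close>
  moreover have "lagrange t x = of_bool (t = T x)" for t x
    using g by (auto simp: lagrange_def inj_eq intro!: prod.neutral prod_zero)
  ultimately show ?thesis
    by (simp add: of_bool_def if_distrib sum.delta' cong: if_cong)
qed

section \<open>Best estimators and multipliers\<close>

lemma UUBUE_if_multiplier:
  assumes mult: "\<And>w :: real \<Rightarrow> real. zero_mean_multiplier (\<lambda>x. w (T x))"
  shows "UUBUE P T"
  unfolding UUBUE_def UBUE_def
proof (intro allI impI)
  fix L :: "'p \<Rightarrow> real \<Rightarrow> real" and S \<theta>
  assume "convex_loss L" and H: "(\<lambda>x. S x - T x) \<in> zero_mean P"
  then have "convex_on UNIV (L \<theta>)"
    by (simp add: convex_loss_def)
  then have "\<exists>g. \<forall>s. L \<theta> t + g * (s - t) \<le> L \<theta> s" for t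
    using convex_le_Inf_differential[of UNIV "L \<theta>" t] by auto
  \<comment> \<open>A choice of subgradient at every point. It may depend on the fixed
    \<open>\<theta>\<close>, since \<open>mult\<close> covers every function of
    \<open>T\<close>.\<close>
  then obtain g where g: "L \<theta> t + g t * (s - t) \<le> L \<theta> s" for s t
    by metis
  have "(\<lambda>x. g (T x) * (S x - T x)) \<in> zero_mean P"
    using mult[of g] H by (simp add: zero_mean_multiplier_def)
  then have "(\<Sum>x\<in>UNIV. g (T x) * (S x - T x) * likelihood P x \<theta>) = 0"
    by (simp add: zero_mean_def integral_eq_sum_likelihood)
  then have "(\<Sum>x\<in>UNIV. L \<theta> (T x) * likelihood P x \<theta>)
      = (\<Sum>x\<in>UNIV. (L \<theta> (T x) + g (T x) * (S x - T x)) * likelihood P x \<theta>)"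
    by (simp add: distrib_right sum.distrib)
  also have "\<dots> \<le> (\<Sum>x\<in>UNIV. L \<theta> (S x) * likelihood P x \<theta>)"
    by (intro sum_mono mult_right_mono g) (simp add: likelihood_def)
  finally show "(\<integral>x. L \<theta> (T x) \<partial>P \<theta>) \<le> (\<integral>x. L \<theta> (S x) \<partial>P \<theta>)"
    by (simp add: integral_eq_sum_likelihood)
qed

lemma multiplier_if_UBUE:
  assumes L: "L \<in> simple_losses" and best: "UBUE P L T"
  shows "zero_mean_multiplier (\<lambda>x. w (T x))"
proof -
  obtain c where c: "L = (\<lambda>\<theta>. c)" "c differentiable_on UNIV" "strictly_convex c"
    using L by (auto simp: simple_losses_def)
  have deriv: "(c has_real_derivative deriv c t) (at t)" for t
    using c(2) by (simp add: differentiable_on_def DERIV_deriv_iff_real_differentiable)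
  have "zero_mean_multiplier (\<lambda>x. deriv c (T x))"
    unfolding zero_mean_multiplier_def
  proof
    fix H assume H: "H \<in> zero_mean P"
    \<comment> \<open>The sum is the derivative at \<open>s = 0\<close> of the risk of
      \<open>T + s H\<close>. Every such statistic has the same expectations as \<open>T\<close>,
      for either sign of \<open>s\<close>, so the risk is minimal at 0.\<close>
    have "(\<Sum>x\<in>UNIV. deriv c (T x) * H x * likelihood P x \<theta>) = 0" for \<theta>
    proof (rule DERIV_local_min)
      let ?risk = "\<lambda>s. \<Sum>x\<in>UNIV. c (T x + s * H x) * likelihood P x \<theta>"
      show "(?risk has_real_derivative (\<Sum>x\<in>UNIV. deriv c (T x) * H x * likelihood P x \<theta>)) (at 0)"
        by (intro DERIV_sum DERIV_cmult_right DERIV_chain2[where f = c])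
          (auto intro!: derivative_eq_intros deriv)
      \<comment> \<open>The minimum is global, so the radius 1 is arbitrary.\<close>
      show "\<forall>s. \<bar>0 - s\<bar> < 1 \<longrightarrow> ?risk 0 \<le> ?risk s"
      proof (intro allI impI)
        fix s
        have "(\<lambda>x. (T x + s * H x) - T x) \<in> zero_mean P"
          using zero_mean_mult[OF H, of s] by simp
        then have "(\<integral>x. c (T x) \<partial>P \<theta>) \<le> (\<integral>x. c (T x + s * H x) \<partial>P \<theta>)"
          using best[unfolded UBUE_def, rule_format, of "\<lambda>x. T x + s * H x" \<theta>] by (simp add: c(1))
        then show "?risk 0 \<le> ?risk s"
          by (simp add: integral_eq_sum_likelihood)
      qed
    qed simp
    then show "(\<lambda>x. deriv c (T x) * H x) \<in> zero_mean P"
      by (simp add: zero_mean_def integral_eq_sum_likelihood)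
  qed
  then show ?thesis
    using strictly_convex_deriv_inj[OF c(3) deriv] by (rule multiplier_fun_of_injective)
qed

text \<open>A cycle of implications: UUBUE gives optimality for one simple loss, this gives the
  multiplier condition, and that gives UUBUE, hence optimality for all simple losses. All meanings
  of \<open>best\<close> thus coincide.\<close>

lemma best_iff_multiplier:
  assumes "best = UUBUE P \<or> (\<exists>L \<in> simple_losses. best = UBUE P L)"
  shows "best T \<longleftrightarrow> (\<forall>w :: real \<Rightarrow> real. zero_mean_multiplier (\<lambda>x. w (T x)))"
proof
  have convex: "convex_loss L" if "L \<in> simple_losses" for L :: "'p \<Rightarrow> real \<Rightarrow> real"
    using that by (auto simp: simple_losses_def convex_loss_def strictly_convex_imp_convex)
  show "\<forall>w :: real \<Rightarrow> real. zero_mean_multiplier (\<lambda>x. w (T x))" if "best T"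
  proof -
    have "UBUE P L T" if "UUBUE P T" "L \<in> simple_losses" for L
      using that convex by (auto simp: UUBUE_def)
    then obtain L where "L \<in> simple_losses" "UBUE P L T"
      using assms \<open>best T\<close> square_simple_loss by blast
    then show ?thesis
      by (blast intro: multiplier_if_UBUE)
  qed
  show "best T" if "\<forall>w :: real \<Rightarrow> real. zero_mean_multiplier (\<lambda>x. w (T x))"
    using assms UUBUE_if_multiplier[of T] that convex unfolding UUBUE_def by blast
qed

text \<open>Multiplying \<open>u \<circ> T\<close> by itself makes its square zero-mean, and a
  nonnegative zero-mean statistic vanishes outside a null set.\<close>

lemma complete_if_multiplier:
  assumes mult: "\<And>w :: real \<Rightarrow> real. zero_mean_multiplier (\<lambda>x. w (T x))"
  shows "complete_statistic P T"
  unfolding complete_statistic_def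
proof (intro ballI impI)
  fix u :: "real \<Rightarrow> real"
  assume "u \<circ> T \<in> zero_mean P"
  then have sq: "(\<lambda>x. u (T x) * u (T x)) \<in> zero_mean P"
    using mult[of u] by (auto simp: zero_mean_multiplier_def o_def)
  have "null_set P {x. u (T x) \<noteq> 0}"
    unfolding null_set_def
  proof
    fix \<theta>
    interpret prob_space "P \<theta>" by (rule prob)
    have "(\<Sum>x\<in>UNIV. u (T x) * u (T x) * likelihood P x \<theta>) = 0"
      using sq by (simp add: zero_mean_def integral_eq_sum_likelihood)
    then have "\<forall>x. u (T x) * u (T x) * likelihood P x \<theta> = 0"
      by (subst (asm) sum_nonneg_eq_0_iff) (auto simp: likelihood_def)
    then have "(\<Sum>x\<in>{x. u (T x) \<noteq> 0}. likelihood P x \<theta>) = 0"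
      by (intro sum.neutral) auto
    then show "prob {x. u (T x) \<noteq> 0} = 0"
      by (subst finite_measure_eq_sum_singleton) (auto simp: sets likelihood_def)
  qed
  then show "\<exists>N. null_set P N \<and> (\<forall>x. x \<notin> N \<longrightarrow> (u \<circ> T) x = 0)"
    by (intro exI[of _ "{x. u (T x) \<noteq> 0}"]) simp
qed

section \<open>Multipliers and independence of the bases\<close>

text \<open>Multiplying by the indicator of one level cuts a relation between basis elements down to
  that level, where the basis is independent.\<close>

lemma independent_family_if_multiplier:
  assumes basis: "\<And>t. t \<in> range T \<Longrightarrow> linear_basis (B t) {likelihood P x | x. T x = t}"
    and mult: "\<And>w :: real \<Rightarrow> real. zero_mean_multiplier (\<lambda>x. w (T x))"
  shows "independent_family (SIGMA t:range T. B t) snd"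
  unfolding independent_family_def
proof (intro allI impI ballI)
  fix J c j
  assume J: "finite J \<and> J \<subseteq> (SIGMA t:range T. B t) \<and> (\<Sum>j\<in>J. c j *\<^sub>R snd j) = 0"
    and j: "j \<in> J"
  have "\<exists>x. T x = fst i \<and> likelihood P x = snd i" if "i \<in> J" for i
    using J that basis[of "fst i"] unfolding linear_basis_def by fastforce
  then obtain r where r: "\<And>i. i \<in> J \<Longrightarrow> T (r i) = fst i \<and> likelihood P (r i) = snd i"
    by metis
  \<comment> \<open>The coefficients are carried over to the representing samples. A pair
    \<open>i\<close> is recovered from \<open>r i\<close>, so each of these sums has at most one
    term; samples outside the image of \<open>r\<close> get 0.\<close>
  define H where "H x = (\<Sum>i\<in>{i\<in>J. r i = x}. c i)" for x
  \<comment> \<open>Used with weight 1 to see that \<open>H\<close> is zero-mean, then with the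
    indicator of the level of \<open>j\<close>.\<close>
  have push: "(\<Sum>x\<in>UNIV. (w (T x) * H x) *\<^sub>R likelihood P x) = (\<Sum>i\<in>J. (w (fst i) * c i) *\<^sub>R snd i)" for w
  proof -
    have "(w (T x) * H x) *\<^sub>R likelihood P x = (\<Sum>i\<in>{i\<in>J. r i = x}. (w (fst i) * c i) *\<^sub>R snd i)" for x
      unfolding H_def sum_distrib_left scaleR_sum_left
      using r by (intro sum.cong) auto
    then show ?thesis
      using J by (simp add: sum.group)
  qed
  have "H \<in> zero_mean P"
    using push[of "\<lambda>_. 1"] J by (simp add: zero_mean_iff)
  then have "(\<lambda>x. of_bool (T x = fst j) * H x) \<in> zero_mean P"
    using mult[of "\<lambda>t. of_bool (t = fst j)"] by (simp add: zero_mean_multiplier_def)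
  then have "0 = (\<Sum>i\<in>J. (of_bool (fst i = fst j) * c i) *\<^sub>R snd i)"
    using push[of "\<lambda>t. of_bool (t = fst j)"] by (simp add: zero_mean_iff)
  also have "\<dots> = (\<Sum>i\<in>{i\<in>J. fst i = fst j}. c i *\<^sub>R snd i)"
    using J by (intro sum.mono_neutral_cong_right) auto
  also have "\<dots> = (\<Sum>b\<in>{b. (fst j, b) \<in> J}. c (fst j, b) *\<^sub>R b)"
    by (rule sum.reindex_bij_witness[where i = "\<lambda>b. (fst j, b)" and j = snd]) auto
  finally have zero: "(\<Sum>b\<in>{b. (fst j, b) \<in> J}. c (fst j, b) *\<^sub>R b) = 0" by simp
  have indep: "independent (B (fst j))"
    using J j basis[of "fst j"] by (auto simp: linear_basis_def)
  have fin: "finite {b. (fst j, b) \<in> J}"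
    using J finite_vimageI[of J "Pair (fst j)"] by (simp add: vimage_def inj_on_def)
  have sub: "{b. (fst j, b) \<in> J} \<subseteq> B (fst j)"
    using J by auto
  have "c (fst j, snd j) = 0"
    by (rule independentD[OF indep fin sub zero]) (simp add: j)
  then show "c j = 0" by simp
qed

text \<open>A relation between likelihoods is grouped by levels and each group \<open>v t\<close> is
  expanded in \<open>B t\<close>. Independence of the whole family makes every \<open>v t\<close>
  vanish, so reweighting the levels preserves the relation.\<close>

lemma multiplier_if_independent_family:
  assumes basis: "\<And>t. t \<in> range T \<Longrightarrow> linear_basis (B t) {likelihood P x | x. T x = t}"
    and indep: "independent_family (SIGMA t:range T. B t) snd"
  shows "zero_mean_multiplier (\<lambda>x. w (T x))"
  unfolding zero_mean_multiplier_def
proof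
  fix H assume H: "H \<in> zero_mean P"
  define v where "v t = (\<Sum>x\<in>{x. T x = t}. H x *\<^sub>R likelihood P x)" for t
  have total: "(\<Sum>x\<in>UNIV. (a (T x) * H x) *\<^sub>R likelihood P x) = (\<Sum>t\<in>range T. a t *\<^sub>R v t)" for a
    by (subst sum.group[of UNIV "range T" T, symmetric])
      (auto simp: v_def scaleR_sum_right intro!: sum.cong)
  have fin: "finite (B t)" if "t \<in> range T" for t
    using basis[OF that] by (auto simp: linear_basis_def intro: finite_subset)
  have "\<exists>c. v t = (\<Sum>b\<in>B t. c b *\<^sub>R b)" if "t \<in> range T" for t
  proof -
    have "v t \<in> span {likelihood P x | x. T x = t}"
      unfolding v_def by (intro span_sum span_scale span_base) auto
    then have "v t \<in> span (B t)"
      using basis[OF that] by (simp add: linear_basis_def)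
    then show ?thesis
      unfolding span_finite[OF fin[OF that]] by auto
  qed
  then obtain c where c: "\<And>t. t \<in> range T \<Longrightarrow> v t = (\<Sum>b\<in>B t. c t b *\<^sub>R b)"
    by metis
  have "(\<Sum>t\<in>range T. v t) = 0"
    using total[of "\<lambda>_. 1"] H by (simp add: zero_mean_iff)
  then have "(\<Sum>i\<in>(SIGMA t:range T. B t). c (fst i) (snd i) *\<^sub>R snd i) = 0"
    using fin by (simp add: c sum.Sigma case_prod_beta)
  moreover have "finite (SIGMA t:range T. B t)"
    using fin by auto
  ultimately have "\<forall>i\<in>(SIGMA t:range T. B t). c (fst i) (snd i) = 0"
    using indep unfolding independent_family_def
    by (elim allE[of _ "SIGMA t:range T. B t"] allE[of _ "\<lambda>i. c (fst i) (snd i)"]) blast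
  then have "v t = 0" if "t \<in> range T" for t
    using that by (auto simp: c intro!: sum.neutral)
  then show "(\<lambda>x. w (T x) * H x) \<in> zero_mean P"
    by (simp add: zero_mean_iff total)
qed

end

theorem mainTheorem2:
  fixes P :: "'p \<Rightarrow> 'x::finite measure"
    and T :: "'x \<Rightarrow> real"
    and B :: "real \<Rightarrow> ('p \<Rightarrow> real) set"
    and best :: "('x \<Rightarrow> real) \<Rightarrow> bool"
  assumes prob: "\<And>\<theta>. prob_space (P \<theta>)"
    and sets: "\<And>\<theta>. sets (P \<theta>) = UNIV"
    and basis: "\<And>t. t \<in> range T \<Longrightarrow> linear_basis (B t) {likelihood P x | x. T x = t}"
    and best: "best = UUBUE P \<or> (\<exists>L \<in> simple_losses. best = UBUE P L)"
  shows "(best T \<longleftrightarrow> independent_family (SIGMA t:range T. B t) snd)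
    \<and> (best T \<longrightarrow> (\<forall>u :: real \<Rightarrow> real. best (u \<circ> T)))
    \<and> (best T \<longrightarrow> complete_statistic P T)"
proof -
  interpret finite_model P
    using prob sets by (rule finite_model.intro)
  note best_iff = best_iff_multiplier[OF best]
  have "best T \<longleftrightarrow> independent_family (SIGMA t:range T. B t) snd"
    unfolding best_iff
    using independent_family_if_multiplier[OF basis] multiplier_if_independent_family[OF basis]
    by blast
  moreover have "best (u \<circ> T)" if "best T" for u :: "real \<Rightarrow> real"
    using that unfolding best_iff
  proof (intro allI)
    fix w :: "real \<Rightarrow> real"
    assume "\<forall>w :: real \<Rightarrow> real. zero_mean_multiplier (\<lambda>x. w (T x))"
    \<comment> \<open>Every function of \<open>u \<circ> T\<close> is a function of
      \<open>T\<close>, so the condition is inherited.\<close>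
    from this[rule_format, of "w \<circ> u"] show "zero_mean_multiplier (\<lambda>x. w ((u \<circ> T) x))"
      by simp
  qed
  moreover have "complete_statistic P T" if "best T"
    using that complete_if_multiplier unfolding best_iff by blast
  ultimately show ?thesis by blast
qed

end
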